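(* Let $m\geq 3$ be an integer and let $p\geq 3$ be an odd prime. Then $$\operatorname{tr}(P_{m,p})=2^p\Big(T\big(a_{m-1}^p,\;a_m+a_{m-1}\big)+2^{m+p-2}-2^{m-2}\Big).$$
   Context: Let $a_i=a_i(c)\in\mathbb{Z}[c]$ be defined by $a_0=0$ and $a_i=a_{i-1}^2+c$ (i.e. $a_i=f_c^i(0)$ with $f_c(z)=z^2+c$). $\mu$ is the Möbius function. For $m\geq 2$, $n\geq 1$, $G_{m,n}\in\mathbb{Z}[c]$ is $\prod_{k\mid n}(a_{m+k-1}+a_{m-1})^{\mu(n/k)}$ if $n\nmid m-1$, and $\prod_{k\mid n}(a_{m+k-1}+a_{m-1})^{\mu(n/k)}\prod_{k\mid n}a_k^{-\mu(n/k)}$ if $n\mid m-1$ (a monic integer polynomial). For a root $\alpha$ of $G_{m,n}$, $\lambda_{m,n}(\alpha)=2^n\prod_{i=0}^{n-1}a_{m+i}(\alpha)$, and $P_{m,n}(x)=\prod_j(x-\lambda_{m,n}(\alpha_j))$ over all roots $\alpha_j$ of $G_{m,n}$ with multiplicity. For a monic polynomial $P$, $\operatorname{tr}(P)$ is the sum of its roots. For polynomials $f,g$ over a field with $g\neq0$, $T(f,g)$ is the sum of $f(\gamma)$ over all roots $\gamma$ of $g$, counted with multiplicity. *)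

theory Defs
  imports
    Complex_Main
    "HOL-Computational_Algebra.Computational_Algebra"
begin

definition moebius :: "nat \<Rightarrow> int" where
  "moebius n = (if squarefree n then (- 1) ^ card (prime_factors n) else 0)"

text \<open>The integer polynomials \<open>a\<^sub>i \<in> \<int>[c]\<close>; the indeterminate \<open>c\<close> is \<open>[:0, 1:]\<close>.\<close>

fun crit_poly :: "nat \<Rightarrow> int poly" where
  "crit_poly 0 = 0"
| "crit_poly (Suc i) = (crit_poly i)\<^sup>2 + [:0, 1:]"

text \<open>The defining product of \<open>G\<^sub>m\<^sub>,\<^sub>n\<close> has negative exponents, so it is formed in the field of
  fractions of \<open>\<int>[c]\<close>.\<close>

definition G_fract :: "nat \<Rightarrow> nat \<Rightarrow> int poly fract" where
  "G_fract m n =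
     (\<Prod>k | k dvd n. to_fract (crit_poly (m + k - 1) + crit_poly (m - 1)) powi moebius (n div k)) *
     (if n dvd m - 1
      then (\<Prod>k | k dvd n. to_fract (crit_poly k) powi (- moebius (n div k)))
      else 1)"

text \<open>Since \<open>to_fract\<close> is injective, there is at most one such integer polynomial.\<close>

definition G_poly :: "nat \<Rightarrow> nat \<Rightarrow> int poly" where
  "G_poly m n = (THE g. to_fract g = G_fract m n)"

definition multiplier :: "nat \<Rightarrow> nat \<Rightarrow> complex \<Rightarrow> complex" where
  "multiplier m n \<alpha> = 2 ^ n * (\<Prod>i<n. poly (map_poly of_int (crit_poly (m + i))) \<alpha>)"

definition P_poly :: "nat \<Rightarrow> nat \<Rightarrow> complex poly" where
  "P_poly m n = (\<Prod>\<alpha>\<in>#proots (map_poly of_int (G_poly m n)). [:- multiplier m n \<alpha>, 1:])"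

text \<open>In the next two definitions the coefficient field is algebraically closed, so that
  \<open>proots\<close> contains all roots, with multiplicity. The trace is only meaningful for monic \<open>P\<close>, and
  \<open>root_sum f g\<close>, which stands for \<open>T(f, g)\<close>, only for \<open>g \<noteq> 0\<close>.\<close>

definition poly_tr :: "'a :: alg_closed_field poly \<Rightarrow> 'a" where
  "poly_tr P = (\<Sum>x\<in>#proots P. x)"

definition root_sum :: "'a :: alg_closed_field poly \<Rightarrow> 'a poly \<Rightarrow> 'a" where
  "root_sum f g = (\<Sum>\<gamma>\<in>#proots g. poly f \<gamma>)"

end

theory Submission
  imports Defs
begin

text \<open>Write \<open>\<Lambda> = a\<^sub>m \<cdots> a\<^sub>m\<^sub>+\<^sub>p\<^sub>-\<^sub>1\<close>, \<open>v = a\<^sub>m + a\<^sub>m\<^sub>-\<^sub>1\<close> and \<open>H = a\<^sub>m\<^sub>+\<^sub>p\<^sub>-\<^sub>1 + a\<^sub>m\<^sub>-\<^sub>1\<close>. Since \<open>p\<close> is prime,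
  \<open>G\<^sub>m\<^sub>,\<^sub>p\<close> is \<open>H / v\<close>, times \<open>a\<^sub>1 / a\<^sub>p\<close> if \<open>p\<close> divides \<open>m - 1\<close>. In the latter case \<open>\<Lambda>\<close> vanishes
  at the roots of \<open>a\<^sub>p\<close> and \<open>a\<^sub>1\<close>, so in any case \<open>tr(P\<^sub>m\<^sub>,\<^sub>p) = 2\<^sup>p (T(\<Lambda>, H) - T(\<Lambda>, v))\<close>. At a root of \<open>v\<close>
  all factors of \<open>\<Lambda>\<close> are equal to \<open>-a\<^sub>m\<^sub>-\<^sub>1\<close>. At a root of \<open>H\<close> we have \<open>\<Lambda> = -B\<close> for
  \<open>B = a\<^sub>m\<^sub>-\<^sub>1 \<cdots> a\<^sub>m\<^sub>+\<^sub>p\<^sub>-\<^sub>2\<close>, and \<open>T(B, H)\<close> is the coefficient of degree \<open>deg H - 1\<close> of the remainder of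
  \<open>B H'\<close> modulo \<open>H\<close>. That remainder can be written down explicitly, because \<open>B\<close> contains the factor
  \<open>a\<^sub>m\<^sub>+\<^sub>p\<^sub>-\<^sub>2\<close>, whose square is \<open>H - a\<^sub>m\<^sub>-\<^sub>1 - c\<close>.\<close>

declare crit_poly.simps(2) [simp del]

lemmas crit_poly_Suc = crit_poly.simps(2)

section \<open>Passage from integer to complex coefficients\<close>

abbreviation cpoly :: "int poly \<Rightarrow> complex poly" where
  "cpoly \<equiv> map_poly of_int"

lemma cpoly_add: "cpoly (p + q) = cpoly p + cpoly q"
  by (intro poly_eqI) (simp add: coeff_map_poly)

lemma cpoly_mult: "cpoly (p * q) = cpoly p * cpoly q"
  by (intro poly_eqI) (simp add: coeff_map_poly coeff_mult)

lemma cpoly_power: "cpoly (p ^ n) = cpoly p ^ n"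
  by (induction n) (simp_all add: cpoly_mult)

lemma cpoly_prod: "cpoly (\<Prod>i\<in>I. f i) = (\<Prod>i\<in>I. cpoly (f i))"
  by (induction I rule: infinite_finite_induct) (simp_all add: cpoly_mult)

lemma cpoly_pderiv: "cpoly (pderiv p) = pderiv (cpoly p)"
  by (intro poly_eqI) (simp add: coeff_map_poly coeff_pderiv)

lemma degree_cpoly: "degree (cpoly p) = degree p"
  by (cases "p = 0") (simp_all add: map_poly_degree_eq)

lemma cpoly_eq_0_iff: "cpoly p = 0 \<longleftrightarrow> p = 0"
  by (subst map_poly_eq_0_iff) auto

section \<open>Sums over the roots of a polynomial\<close>

lemma root_sum_mult:
  "f \<noteq> 0 \<Longrightarrow> g \<noteq> 0 \<Longrightarrow> root_sum h (f * g) = root_sum h f + root_sum h g"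
  by (simp add: root_sum_def proots_mult)

lemma root_sum_uminus: "root_sum (- f) g = - root_sum f g"
proof -
  have "(\<Sum>x\<in>#M. - poly f x) = - (\<Sum>x\<in>#M. poly f x)" for M
    by (induction M) simp_all
  thus ?thesis by (simp add: root_sum_def)
qed

lemma root_sum_cong:
  assumes "g \<noteq> 0" "\<And>x. poly g x = 0 \<Longrightarrow> poly f1 x = poly f2 x"
  shows "root_sum f1 g = root_sum f2 g"
  unfolding root_sum_def using assms by (intro arg_cong[of _ _ sum_mset] image_mset_cong) auto

lemma prod_linear_nonzero: "(\<Prod>x\<in>#A. [:- x, 1 :: 'a :: idom:]) \<noteq> 0"
  by (auto simp: prod_mset_zero_iff)

lemma proots_prod_linear: "proots (\<Prod>x\<in>#A. [:- x, 1 :: 'a :: idom:]) = A"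
proof (induction A)
  case (add a A)
  have "proots ([:- a, 1:] * (\<Prod>x\<in>#A. [:- x, 1:])) = {#a#} + A"
    using add prod_linear_nonzero[of A] by (subst proots_mult) auto
  thus ?case by simp
qed simp

lemma monic_eq_prod_proots:
  fixes g :: "'a :: alg_closed_field poly"
  assumes "lead_coeff g = 1"
  shows "g = (\<Prod>x\<in>#proots g. [:- x, 1:])" "size (proots g) = degree g"
proof -
  obtain M where "size M = degree g" "g = (\<Prod>x\<in>#M. [:- x, 1:])"
    using alg_closed_imp_factorization[of g] assms by fastforce
  thus "g = (\<Prod>x\<in>#proots g. [:- x, 1:])" "size (proots g) = degree g"
    using proots_prod_linear by metis+
qed

text \<open>The idea is that \<open>f * g' = (\<Sum>\<^sub>x f * g / (X - x))\<close>, where \<open>f\<close> may be replaced by the constant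
  \<open>poly f x\<close> in the summand of the root \<open>x\<close> when working modulo \<open>g\<close>.\<close>

lemma mult_pderiv_prod_linear:
  fixes f :: "'a :: field poly"
  shows "\<exists>Q R. f * pderiv (\<Prod>x\<in>#M. [:- x, 1:]) = (\<Prod>x\<in>#M. [:- x, 1:]) * Q + R \<and>
    (\<forall>i\<ge>size M. coeff R i = 0) \<and> coeff R (size M - 1) = (\<Sum>x\<in>#M. poly f x)"
proof (induction M)
  case empty
  show ?case by (intro exI[of _ 0]) simp
next
  case (add a M)
  define g where "g = (\<Prod>x\<in>#M. [:- x, 1:])"
  define L where "L = [:- a, 1:]"
  obtain Q R where QR: "f * pderiv g = g * Q + R"
    "\<And>i. i \<ge> size M \<Longrightarrow> coeff R i = 0" "coeff R (size M - 1) = (\<Sum>x\<in>#M. poly f x)"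
    using add unfolding g_def by blast
  have "degree g = size M \<and> lead_coeff g = 1"
    unfolding g_def
  proof (induction M)
    case (add b N)
    have "degree ([:- b, 1:] * (\<Prod>x\<in>#N. [:- x, 1:])) = Suc (size N)"
      using add prod_linear_nonzero[of N] by (subst degree_mult_eq) auto
    moreover have "lead_coeff ([:- b, 1:] * (\<Prod>x\<in>#N. [:- x, 1:])) = 1"
      using add by (subst lead_coeff_mult) auto
    ultimately show ?case
      by (simp only: image_mset_add_mset prod_mset.add_mset size_add_mset)
  qed simp
  hence g: "coeff g (size M) = 1" "\<And>i. i > size M \<Longrightarrow> coeff g i = 0"
    by (auto simp: coeff_eq_0)
  have "[:- a, 1:] dvd f - [:poly f a:]"
    by (simp add: poly_eq_0_iff_dvd[symmetric])
  then obtain q where q: "f = L * q + [:poly f a:]"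
    unfolding L_def by (metis add.commute diff_add_cancel dvdE)
  define R' where "R' = smult (poly f a) g + L * R"
  have "pderiv L = 1"
    by (simp add: L_def pderiv_pCons one_pCons)
  hence "f * pderiv (L * g) = f * g + L * (f * pderiv g)"
    by (simp add: pderiv_mult algebra_simps)
  also have "f * g = L * g * q + smult (poly f a) g"
    by (subst q) (simp add: algebra_simps)
  finally have "f * pderiv (L * g) = L * g * (q + Q) + R'"
    unfolding QR R'_def by (simp add: algebra_simps)
  moreover have "coeff R' i = 0" if "i \<ge> Suc (size M)" for i
    using that g QR(2) by (cases i) (simp_all add: R'_def L_def)
  \<comment> \<open>\<open>g\<close> is monic of degree \<open>size M\<close> and contributes
    \<open>poly f a\<close>; multiplying by \<open>L\<close> shifts the top coefficient of
    \<open>R\<close> up by one. If \<open>M\<close> is empty, \<open>size M - 1\<close> is 0 and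
    \<open>R\<close> is 0.\<close>
  moreover have "coeff R' (size M) = poly f a + (\<Sum>x\<in>#M. poly f x)"
    using g QR(2)[of "size M"] QR(3)
    by (cases "size M") (simp_all add: R'_def L_def)
  ultimately show ?case
    by (intro exI[of _ "q + Q"] exI[of _ R']) (simp add: L_def g_def)
qed

text \<open>Remainders modulo \<open>g\<close> are unique, so the root sum can be read off any
  explicitly known remainder.\<close>

lemma root_sum_eq_coeff:
  fixes f g Q R :: "'a :: alg_closed_field poly"
  assumes monic: "lead_coeff g = 1" and eq: "f * pderiv g = g * Q + R" and deg: "degree R < degree g"
  shows "root_sum f g = coeff R (degree g - 1)"
proof -
  obtain Q' R' where *: "f * pderiv g = g * Q' + R'"
    "\<And>i. i \<ge> degree g \<Longrightarrow> coeff R' i = 0" "coeff R' (degree g - 1) = root_sum f g"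
    using mult_pderiv_prod_linear[of f "proots g"]
    unfolding monic_eq_prod_proots[OF monic, symmetric] root_sum_def by blast
  have "degree R' < degree g"
    using *(2) deg by (intro degree_lessI) auto
  hence "degree (R' - R) < degree g"
    using deg by (rule degree_diff_less)
  moreover have "R' - R = g * (Q - Q')"
    using eq *(1) by (simp add: algebra_simps)
  ultimately have "R' = R"
    using degree_mult_right_le[of "Q - Q'" g] by (cases "Q = Q'") (auto simp: mult.commute)
  with * show ?thesis by simp
qed

text \<open>\<open>P_poly\<close> is a product of linear factors, so its roots are the multipliers
  it was built from.\<close>

lemma poly_tr_P_poly: "poly_tr (P_poly m n) =
  2 ^ n * root_sum (cpoly (\<Prod>i<n. crit_poly (m + i))) (cpoly (G_poly m n))"
proof -
  have "proots (P_poly m n) = image_mset (multiplier m n) (proots (cpoly (G_poly m n)))"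
    using proots_prod_linear[of "image_mset (multiplier m n) (proots (cpoly (G_poly m n)))"]
    by (simp add: P_poly_def multiset.map_comp comp_def)
  moreover have "multiplier m n = (\<lambda>x. 2 ^ n * poly (cpoly (\<Prod>i<n. crit_poly (m + i))) x)"
    by (simp add: fun_eq_iff multiplier_def cpoly_prod poly_prod)
  ultimately show ?thesis
    by (simp add: poly_tr_def root_sum_def sum_mset_distrib_left multiset.map_comp comp_def)
qed

section \<open>Degrees and divisibility along the critical orbit\<close>

lemma crit_poly_degree_monic: "degree (crit_poly (Suc i)) = 2 ^ i \<and> lead_coeff (crit_poly (Suc i)) = 1"
proof (induction i)
  case (Suc i)
  moreover from this have "crit_poly (Suc i) \<noteq> 0" by auto
  ultimately have "degree ((crit_poly (Suc i))\<^sup>2) = 2 ^ Suc i" "lead_coeff ((crit_poly (Suc i))\<^sup>2) = 1"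
    unfolding lead_coeff_power by (auto simp: degree_power_eq)
  moreover have "degree [:0, 1 :: int:] < 2 ^ Suc i"
    using one_less_power[of "2::nat" "Suc i"] by simp
  ultimately show ?case
    unfolding crit_poly_Suc[of "Suc i"]
    by (simp add: degree_add_eq_left lead_coeff_add_le coeff_eq_0)
qed (simp add: crit_poly_Suc)

lemmas degree_crit_poly = crit_poly_degree_monic[THEN conjunct1]
  and lead_coeff_crit_poly = crit_poly_degree_monic[THEN conjunct2]

lemma crit_poly_Suc_nonzero: "crit_poly (Suc i) \<noteq> 0"
  using lead_coeff_crit_poly[of i] by (metis coeff_0 zero_neq_one)

text \<open>\<open>x - y\<close> divides \<open>f x - f y\<close> for \<open>f z = z^2 + c\<close>;
  iterate from \<open>x = crit_poly n\<close> and \<open>y = 0\<close>.\<close>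

lemma crit_poly_dvd_diff: "crit_poly n dvd crit_poly (n + j) - crit_poly j"
proof (induction j)
  case (Suc j)
  have "crit_poly (n + Suc j) - crit_poly (Suc j) =
    (crit_poly (n + j) - crit_poly j) * (crit_poly (n + j) + crit_poly j)"
    by (simp add: crit_poly_Suc algebra_simps power2_eq_square)
  with Suc show ?case by simp
qed simp

lemma crit_poly_dvd: "n dvd k \<Longrightarrow> crit_poly n dvd crit_poly k"
proof (elim dvdE, hypsubst)
  fix j show "crit_poly n dvd crit_poly (n * j)"
  proof (induction j)
    case (Suc j)
    thus ?case using crit_poly_dvd_diff[of n "n * j"]
      by (simp add: dvd_diff_left_iff)
  qed simp
qed

text \<open>Opposite elements have equal squares: modulo the divisor, the orbit is stationary from
  index \<open>Suc r\<close> on.\<close>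

lemma fixed_dvd_diff:
  "crit_poly (Suc r) + crit_poly r dvd crit_poly (Suc r + i) - crit_poly (Suc r)"
proof (induction i)
  case (Suc i)
  have "crit_poly (Suc r + Suc i) - crit_poly (Suc r) =
    (crit_poly (Suc r + i) - crit_poly (Suc r)) * (crit_poly (Suc r + i) + crit_poly (Suc r)) +
    (crit_poly (Suc r) + crit_poly r) * (crit_poly (Suc r) - crit_poly r)"
    by (simp add: crit_poly_Suc algebra_simps power2_eq_square)
  with Suc show ?case by (metis dvd_add dvd_mult2 dvd_triv_left)
qed simp

lemma sum_crit_poly_degree_monic:
  assumes "i \<le> n"
  shows "degree (crit_poly (Suc n) + crit_poly i) = 2 ^ n"
    and "lead_coeff (crit_poly (Suc n) + crit_poly i) = 1"
proof -
  have "degree (crit_poly i) < 2 ^ n"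
  proof (cases i)
    case (Suc j)
    thus ?thesis using assms unfolding Suc degree_crit_poly by simp
  qed simp
  thus "degree (crit_poly (Suc n) + crit_poly i) = 2 ^ n"
    and "lead_coeff (crit_poly (Suc n) + crit_poly i) = 1"
    using degree_crit_poly[of n] lead_coeff_crit_poly[of n]
    by (simp_all add: degree_add_eq_left coeff_eq_0)
qed

lemma sum_crit_poly_nonzero: "i \<le> n \<Longrightarrow> crit_poly (Suc n) + crit_poly i \<noteq> 0"
  using sum_crit_poly_degree_monic(2)[of i n] by (metis coeff_0 zero_neq_one)

lemma prod_crit_poly_degree_monic:
  "degree (\<Prod>i<k. crit_poly (Suc r + i)) = 2 ^ (r + k) - 2 ^ r"
  "lead_coeff (\<Prod>i<k. crit_poly (Suc r + i)) = 1"
proof -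
  have "(\<Sum>i<k. 2 ^ (r + i)) = (2 ^ (r + k) - 2 ^ r :: nat)"
    by (induction k) simp_all
  thus "degree (\<Prod>i<k. crit_poly (Suc r + i)) = 2 ^ (r + k) - 2 ^ r"
    using crit_poly_Suc_nonzero degree_crit_poly
    by (subst degree_prod_sum_eq) simp_all
  show "lead_coeff (\<Prod>i<k. crit_poly (Suc r + i)) = 1"
    using lead_coeff_crit_poly by (simp add: lead_coeff_prod)
qed

lemma pderiv_crit_poly:
  "pderiv (crit_poly (Suc i)) = 2 * crit_poly i * pderiv (crit_poly i) + 1"
  by (simp add: crit_poly_Suc power2_eq_square pderiv_mult pderiv_add pderiv_pCons one_pCons algebra_simps)

section \<open>The root sum of \<open>B\<close> over \<open>H\<close>\<close>

lemma root_sum_prod_crit_poly: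
  assumes "r \<ge> 1"
  shows "root_sum (cpoly (\<Prod>i<Suc k. crit_poly (Suc r + i)))
    (cpoly (crit_poly (r + k + 2) + crit_poly (Suc r))) = 2 ^ r - 2 ^ (r + k + 1)"
proof -
  define C where "C = (\<Prod>i<k. crit_poly (Suc r + i))"
  define B where "B = (\<Prod>i<Suc k. crit_poly (Suc r + i))"
  define a where "a = crit_poly (Suc r)"
  define e where "e = crit_poly (r + k + 1)"
  define H where "H = crit_poly (r + k + 2) + a"
  \<comment> \<open>\<open>U - 2 * S\<close> is the remainder of \<open>B * pderiv H\<close> modulo \<open>H\<close>, obtained by rewriting
    \<open>e\<^sup>2\<close> as \<open>H - a - c\<close>; both parts have the full degree \<open>degree H - 1\<close>.\<close>
  define S where "S = C * (pderiv e * (a + [:0, 1:]))"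
  define U where "U = B * (1 + pderiv a)"
  define d :: nat where "d = 2 ^ (r + k + 1) - 1"
  have B: "B = C * e"
    by (simp add: B_def C_def e_def)
  have H: "H = e\<^sup>2 + [:0, 1:] + a"
    by (simp add: H_def e_def crit_poly_Suc)
  have dH: "pderiv H = 2 * e * pderiv e + 1 + pderiv a"
    using pderiv_crit_poly[of "r + k + 1"] by (simp add: H_def e_def pderiv_add)
  have eq: "B * pderiv H = H * (2 * C * pderiv e) + (U - 2 * S)"
    unfolding dH unfolding B S_def U_def H by (simp add: algebra_simps power2_eq_square)
  have a: "degree a = 2 ^ r" "lead_coeff a = 1"
    unfolding a_def using crit_poly_degree_monic[of r] by auto
  have e: "degree e = 2 ^ (r + k)" "lead_coeff e = 1"
    unfolding e_def using crit_poly_degree_monic[of "r + k"] by auto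
  have degH: "degree H = Suc d" "lead_coeff H = 1"
    using sum_crit_poly_degree_monic[of "Suc r" "r + k + 1"]
    by (simp_all add: H_def a_def d_def)
  have C: "degree C = 2 ^ (r + k) - 2 ^ r" "lead_coeff C = 1"
    using prod_crit_poly_degree_monic[of r k] unfolding C_def by auto
  have B': "degree B = 2 ^ (r + k + 1) - 2 ^ r" "lead_coeff B = 1"
    using prod_crit_poly_degree_monic[of r "Suc k"] unfolding B_def by auto
  \<comment> \<open>For \<open>r = 0\<close> we would have \<open>a + c = 2 * c\<close>, which is not monic.\<close>
  have "(2::nat) ^ 1 \<le> 2 ^ r"
    using assms by (intro power_increasing) auto
  hence "degree [:0, 1 :: int:] < degree a"
    by (simp add: a)
  hence ac: "degree (a + [:0, 1:]) = 2 ^ r" "lead_coeff (a + [:0, 1:]) = 1"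
    using a by (simp_all add: degree_add_eq_left coeff_eq_0)
  \<comment> \<open>This needs \<open>r \<ge> 1\<close> as well: for \<open>r = 0\<close>,
    \<open>1 + pderiv a\<close> would be 2 instead of having leading coefficient
    \<open>2 ^ r\<close>.\<close>
  have "degree (1 :: int poly) < degree (pderiv a)"
    using \<open>degree [:0, 1 :: int:] < degree a\<close> by (simp add: degree_pderiv)
  hence da: "degree (1 + pderiv a) = 2 ^ r - 1" "lead_coeff (1 + pderiv a) = 2 ^ r"
    using a by (simp_all add: degree_add_eq_right degree_pderiv coeff_eq_0 coeff_pderiv)
  have de: "degree (pderiv e) = 2 ^ (r + k) - 1" "lead_coeff (pderiv e) = 2 ^ (r + k)"
    using e by (simp_all add: degree_pderiv coeff_pderiv)
  have rk: "(2::nat) ^ r \<le> 2 ^ (r + k)" "(2::nat) ^ r \<ge> 1" by simp_all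
  have nz: "C \<noteq> 0" "B \<noteq> 0" "pderiv e \<noteq> 0" "a + [:0, 1:] \<noteq> 0" "1 + pderiv a \<noteq> 0"
    unfolding leading_coeff_0_iff[symmetric] using B'(2) C(2) ac(2) da(2) de(2) by simp_all
  \<comment> \<open>The degrees of the three factors add up to
    \<open>(2^(r+k) - 2^r) + (2^(r+k) - 1) + 2^r = d\<close>.\<close>
  have degS: "degree S = d"
    using nz C ac de rk by (simp add: S_def degree_mult_eq d_def)
  have "lead_coeff S = 2 ^ (r + k)"
    unfolding S_def lead_coeff_mult using C ac de by auto
  hence S: "coeff S d = 2 ^ (r + k)"
    using degS by simp
  have degU: "degree U = d"
  proof -
    have "degree U = (2 ^ (r + k + 1) - 2 ^ r) + (2 ^ r - 1)"
      using nz B' da by (simp add: U_def degree_mult_eq)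
    moreover have "(2::nat) ^ r \<le> 2 ^ (r + k + 1)"
      by (rule power_increasing) auto
    ultimately show ?thesis
      using rk(2) unfolding d_def by linarith
  qed
  have "lead_coeff U = 2 ^ r"
    unfolding U_def lead_coeff_mult using B' da by auto
  hence U: "coeff U d = 2 ^ r"
    using degU by simp
  have "root_sum (cpoly B) (cpoly H) = coeff (cpoly (U - 2 * S)) (degree (cpoly H) - 1)"
  proof (rule root_sum_eq_coeff)
    show "lead_coeff (cpoly H) = 1"
      using degH by (simp add: degree_cpoly coeff_map_poly)
    show "cpoly B * pderiv (cpoly H) = cpoly H * cpoly (2 * C * pderiv e) + cpoly (U - 2 * S)"
      unfolding cpoly_mult[symmetric] cpoly_add[symmetric] cpoly_pderiv[symmetric] eq ..
    have "degree (U - 2 * S) \<le> d"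
      using degS degU degree_smult_le[of 2 S] by (intro degree_diff_le) (auto simp: numeral_poly)
    thus "degree (cpoly (U - 2 * S)) < degree (cpoly H)"
      by (simp add: degree_cpoly degH)
  qed
  also have "\<dots> = 2 ^ r - 2 ^ (r + k + 1)"
    using S U by (simp add: degree_cpoly degH coeff_map_poly numeral_poly)
  finally show ?thesis
    by (simp only: B_def H_def a_def)
qed

section \<open>The polynomial \<open>G\<close> for a prime period\<close>

lemma G_fract_prime:
  assumes "prime p"
  shows "G_fract (Suc r) p = to_fract (crit_poly (r + p) + crit_poly r) /
    to_fract (crit_poly (Suc r) + crit_poly r) *
    (if p dvd r then to_fract (crit_poly 1) / to_fract (crit_poly p) else 1)"
proof -
  have div: "{k. k dvd p} = {1, p}"
    using assms by (auto simp: prime_nat_iff)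
  have mu: "moebius 1 = 1" "moebius p = - 1"
    using assms by (simp_all add: moebius_def squarefree_prime prime_factorization_prime)
  have "p \<noteq> 1" "p > 0"
    using assms by (auto simp: prime_gt_0_nat)
  thus ?thesis
    using mu by (simp add: G_fract_def div field_simps power_int_minus)
qed

text \<open>\<open>G_poly\<close> is a definite description, so the fraction must first be shown to
  be a polynomial. The form without denominators suits \<open>root_sum_mult\<close>.\<close>

lemma G_poly_prime:
  assumes "prime p"
  shows "G_poly (Suc r) p * ((crit_poly (Suc r) + crit_poly r) * (if p dvd r then crit_poly p else 1)) =
    (crit_poly (r + p) + crit_poly r) * (if p dvd r then crit_poly 1 else 1)"
    (is "_ * (?v * ?y) = ?H * ?x")
proof -
  obtain q where q: "p = Suc q"
    using prime_gt_0_nat[OF assms] by (metis gr0_implies_Suc)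
  \<comment> \<open>Modulo \<open>?v\<close>, \<open>crit_poly (r + p)\<close> equals
    \<open>crit_poly (Suc r)\<close>, which turns \<open>?H\<close> into \<open>?v\<close>.\<close>
  have v: "?v dvd ?H"
    using dvd_add[OF fixed_dvd_diff[of r q] dvd_refl] by (simp add: q)
  have "?v * ?y dvd ?H * ?x"
  proof (cases "p dvd r")
    case True
    obtain s where s: "crit_poly q = crit_poly 1 * s"
      using crit_poly_dvd[of 1 q] by auto
    \<comment> \<open>With \<open>c = crit_poly 1\<close>,
      \<open>crit_poly p = (c * s)^2 + c = c * u\<close>.\<close>
    define u where "u = crit_poly 1 * s\<^sup>2 + 1"
    have p: "crit_poly p = crit_poly 1 * u"
      by (simp add: q s u_def crit_poly_Suc algebra_simps power2_eq_square)
    have u: "u dvd crit_poly k" if "p dvd k" for k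
      using crit_poly_dvd[OF that] unfolding p by (rule dvd_mult_right)
    \<comment> \<open>Modulo \<open>u\<close>, \<open>crit_poly r\<close> vanishes, so \<open>?v\<close> reduces to the indeterminate, modulo which
      \<open>u\<close> is \<open>1\<close>.\<close>
    have "coprime u ?v"
    proof (rule coprimeI)
      fix d assume d: "d dvd u" "d dvd ?v"
      have "d dvd crit_poly r"
        using u[OF True] d by (blast intro: dvd_trans)
      moreover have "crit_poly 1 = ?v - crit_poly r * (crit_poly r + 1)"
        by (simp add: crit_poly_Suc algebra_simps power2_eq_square)
      ultimately have "d dvd crit_poly 1"
        using d by (simp add: dvd_diff)
      thus "d dvd 1"
        using d(1) unfolding u_def by (simp add: dvd_add_right_iff)
    qed
    \<comment> \<open>\<open>u\<close> divides both summands of \<open>?H\<close>, since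
      \<open>p\<close> divides \<open>r\<close> and \<open>r + p\<close>.\<close>
    hence "u * ?v dvd ?H"
      using u[of "r + p"] u[OF True] True v by (intro divides_mult) auto
    thus ?thesis
      using mult_dvd_mono[OF dvd_refl[of "crit_poly 1"]] True by (simp add: p mult_ac)
  qed (use v in simp)
  then obtain g where g: "?H * ?x = ?v * ?y * g" ..
  have nz: "?v \<noteq> 0" "?y \<noteq> 0"
    using sum_crit_poly_nonzero[of r r] crit_poly_Suc_nonzero[of q] q
    by auto
  have "G_fract (Suc r) p = to_fract (?H * ?x) / to_fract (?v * ?y)"
    unfolding G_fract_prime[OF assms] by auto
  also have "\<dots> = to_fract g"
    unfolding g using nz by (simp del: to_fract_add)
  finally have "G_poly (Suc r) p = g"
    unfolding G_poly_def by auto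
  thus ?thesis using g by (simp add: mult_ac)
qed

section \<open>Assembly of the trace formula\<close>

theorem theorem2p9:
  fixes m p :: nat
  assumes "m \<ge> 3" and "prime p" and "odd p" and "p \<ge> 3"
  shows "poly_tr (P_poly m p) =
    2 ^ p * (root_sum (map_poly of_int (crit_poly (m - 1) ^ p))
                      (map_poly of_int (crit_poly m + crit_poly (m - 1)))
             + 2 ^ (m + p - 2) - 2 ^ (m - 2))"
proof -
  define r where "r = m - 2"
  have m: "m = Suc (Suc r)" and r: "r \<ge> 1"
    using assms(1) by (simp_all add: r_def)
  obtain q where q: "p = Suc q"
    using \<open>p \<ge> 3\<close> by (cases p) auto
  define a where "a i = cpoly (crit_poly i)" for i
  define A where "A = (\<Prod>i<p. a (m + i))"
  define v where "v = a (Suc (Suc r)) + a (Suc r)"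
  define H where "H = a (Suc r + p) + a (Suc r)"
  define G where "G = cpoly (G_poly m p)"
  have poly_a_Suc: "poly (a (Suc i)) x = poly (a i) x ^ 2 + x" for i x
    by (simp add: a_def crit_poly_Suc cpoly_add cpoly_power map_poly_pCons)
  have nz: "v \<noteq> 0" "H \<noteq> 0" "a 1 \<noteq> 0" "a p \<noteq> 0"
    using sum_crit_poly_nonzero[of "Suc r" "Suc r"] crit_poly_Suc_nonzero[of q]
      sum_crit_poly_nonzero[of "Suc r" "Suc r + q"] crit_poly_Suc_nonzero[of 0]
    by (auto simp add: v_def H_def a_def q cpoly_eq_0_iff simp flip: cpoly_add)

  have "root_sum A v = root_sum (- cpoly (crit_poly (m - 1) ^ p)) v"
  proof (rule root_sum_cong[OF nz(1)])
    fix x assume x: "poly v x = 0"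
    \<comment> \<open>From index \<open>m\<close> on, the critical orbit is constant.\<close>
    have "poly (a (m + i)) x = - poly (a (Suc r)) x" for i
    proof (induction i)
      case 0
      thus ?case using x by (simp add: v_def m add_eq_0_iff)
    next
      case (Suc i)
      have "poly (a (Suc (m + i))) x = poly (a (Suc (Suc r))) x"
        by (subst (1 2) poly_a_Suc) (simp add: Suc)
      thus ?case using x by (simp add: v_def m add_eq_0_iff)
    qed
    hence "poly A x = (- poly (a (Suc r)) x) ^ p"
      by (simp add: A_def poly_prod)
    thus "poly A x = poly (- cpoly (crit_poly (m - 1) ^ p)) x"
      using \<open>odd p\<close> by (simp add: cpoly_power a_def m)
  qed
  hence A_v: "root_sum A v = - root_sum (cpoly (crit_poly (m - 1) ^ p)) v"
    by (simp add: root_sum_uminus)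

  have "root_sum A H = root_sum (- cpoly (\<Prod>i<Suc q. crit_poly (Suc r + i))) H"
  proof (rule root_sum_cong[OF nz(2)])
    fix x assume x: "poly H x = 0"
    \<comment> \<open>\<open>A\<close> and the shifted product share all factors but one; the
      remaining two, \<open>a (Suc r + p)\<close> and \<open>a (Suc r)\<close>, are opposite at
      \<open>x\<close>.\<close>
    have "A = (\<Prod>i<q. a (Suc (Suc r) + i)) * a (Suc r + p)"
      by (simp add: A_def q m)
    moreover have "cpoly (\<Prod>i<Suc q. crit_poly (Suc r + i)) =
        a (Suc r) * (\<Prod>i<q. a (Suc (Suc r) + i))"
      by (subst prod.lessThan_Suc_shift) (simp add: cpoly_mult cpoly_prod a_def)
    ultimately show "poly A x = poly (- cpoly (\<Prod>i<Suc q. crit_poly (Suc r + i))) x"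
      using x by (simp add: H_def add_eq_0_iff)
  qed
  moreover have "H = cpoly (crit_poly (r + q + 2) + crit_poly (Suc r))"
    by (simp add: H_def a_def q cpoly_add)
  ultimately have A_H: "root_sum A H = 2 ^ (m + p - 2) - 2 ^ (m - 2)"
    using root_sum_prod_crit_poly[OF r, of q] by (simp add: root_sum_uminus m q)

  \<comment> \<open>The last factor of \<open>A\<close> has index
    \<open>m + q = (m - 1) + p\<close>, a multiple of \<open>p\<close> and hence of
    \<open>k\<close>.\<close>
  have A_0: "root_sum A (a k) = 0" if "k dvd p" "p dvd Suc r" "a k \<noteq> 0" for k
  proof -
    have "k dvd Suc r + p"
      using that dvd_trans[of k p "Suc r"] by (intro dvd_add) auto
    then obtain h where "crit_poly (m + q) = crit_poly k * h"
      using crit_poly_dvd[of k "m + q"] by (auto simp: m q elim!: dvdE)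
    hence "a k dvd a (m + q)"
      by (simp add: a_def cpoly_mult)
    also have "a (m + q) dvd A"
      unfolding A_def by (rule dvd_prodI) (auto simp: q)
    finally have "a k dvd A" .
    hence "root_sum A (a k) = root_sum 0 (a k)"
      using that by (intro root_sum_cong) (auto elim!: dvdE)
    thus ?thesis by (simp add: root_sum_def)
  qed

  \<comment> \<open>\<open>root_sum\<close> is additive over products, and by \<open>A_0\<close> the
    extra factors \<open>a 1\<close> and \<open>a p\<close> contribute nothing.\<close>
  have A_G: "root_sum A G + root_sum A v = root_sum A H"
  proof (cases "p dvd Suc r")
    case True
    have eq: "G * (v * a p) = H * a 1"
      using G_poly_prime[OF \<open>prime p\<close>, of "Suc r"] True
      unfolding G_def v_def H_def a_def m
      by (simp only: if_True flip: cpoly_mult cpoly_add)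
    hence "G \<noteq> 0" using nz by auto
    thus ?thesis
      using arg_cong[OF eq, of "root_sum A"] nz True by (simp add: root_sum_mult A_0)
  next
    case False
    have eq: "G * v = H"
      using G_poly_prime[OF \<open>prime p\<close>, of "Suc r"] False
      unfolding G_def v_def H_def a_def m
      by (simp only: if_False mult_1_right flip: cpoly_mult cpoly_add)
    hence "G \<noteq> 0" using nz by auto
    thus ?thesis
      using arg_cong[OF eq, of "root_sum A"] nz by (simp add: root_sum_mult)
  qed
  have v: "v = cpoly (crit_poly m + crit_poly (m - 1))"
    by (simp add: v_def a_def m cpoly_add)
  have "poly_tr (P_poly m p) = 2 ^ p * root_sum A G"
    by (simp add: poly_tr_P_poly A_def G_def a_def cpoly_prod)
  also have "root_sum A G = root_sum A H - root_sum A v"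
    using A_G by (simp add: algebra_simps)
  finally show ?thesis
    unfolding A_v A_H unfolding v by (simp add: algebra_simps)
qed

end
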